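(* Let $f:\Theta^*\to Z$. Then $f$ is mixed-Nash-implementable on the state space $\Theta_{\mathbb R}=\{(\theta,u):\theta\in\Theta^*,u\in\Omega^{[\succeq^\theta,\mathbb R]}\}$ (with $f(\theta,u)=f(\theta)$) if and only if it is mixed-Nash-implementable on the state space $\Theta_{\mathbb Q}=\{(\theta,u):\theta\in\Theta^*,u\in\Omega^{[\succeq^\theta,\mathbb Q]}\}$ (with $f(\theta,u)=f(\theta)$). Explicitly: there is a mechanism $\mathcal M$ with $\bigcup_{\lambda\in MNE^{(\mathcal M,u)}}\mathrm{SUPP}(g[\lambda])=\{f(\theta)\}$ for all $\theta\in\Theta^*$ and all $u\in\Omega^{[\succeq^\theta,\mathbb R]}$ iff there is a mechanism with the same property for all $\theta\in\Theta^*$ and all $u\in\Omega^{[\succeq^\theta,\mathbb Q]}$.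
   Context: Ordinal model: $\mathcal I=\{1,\dots,I\}$ finite with $I\ge3$; $Z$ finite; $Y=\Delta(Z)$; $\Theta^*$ is a finite set of ordinal states, each $\theta\in\Theta^*$ specifying a profile $(\succeq_i^\theta)_{i\in\mathcal I}$ of complete preorders on $Z$; $f:\Theta^*\to Z$ with $|f(\Theta^* )|\ge 2$. For a field $\mathbb K\in\{\mathbb R,\mathbb Q\}$, $\Omega^{[\succeq^\theta,\mathbb K]}$ is the set of profiles $u=(u_i:Z\to\mathbb K)_{i}$ with $z\succeq_i^\theta z'\iff u_i(z)\ge u_i(z')$ for all $i,z,z'$. At cardinal state $u$, agent $i$ evaluates $y\in Y$ by $U_i(y)=\sum_z y_zu_i(z)$. A mechanism $\mathcal M=\langle M=\times_iM_i,g:M\to Y\rangle$ has countable $M_i$; $g(\lambda)$ is the lottery induced by a profile $\lambda$; $MNE^{(\mathcal M,u)}$ is the set of mixed-strategy Nash equilibria under utilities $u$. *)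

theory Defs
  imports "HOL-Probability.Probability"
begin

text \<open>Ordinal model. Agents form a finite type 'i, outcomes a finite type 'z,
  lotteries Y = Delta(Z) are 'z pmf. Countable message spaces M_i are encoded
  as (nonempty) subsets of nat.\<close>

definition complete_preorder :: "('z \<Rightarrow> 'z \<Rightarrow> bool) \<Rightarrow> bool" where
  "complete_preorder R \<longleftrightarrow> (\<forall>x y. R x y \<or> R y x) \<and> (\<forall>x y w. R x y \<longrightarrow> R y w \<longrightarrow> R x w)"

definition cardinal_states ::
  "('i \<Rightarrow> 'z \<Rightarrow> 'z \<Rightarrow> bool) \<Rightarrow> real set \<Rightarrow> ('i \<Rightarrow> 'z \<Rightarrow> real) set" where
  "cardinal_states pref K =
     {u. (\<forall>i z z'. pref i z z' \<longleftrightarrow> u i z \<ge> u i z') \<and> (\<forall>i z. u i z \<in> K)}"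

definition exp_util :: "('z::finite \<Rightarrow> real) \<Rightarrow> 'z pmf \<Rightarrow> real" where
  "exp_util v y = (\<Sum>z\<in>UNIV. pmf y z * v z)"

definition induced_lottery ::
  "(('i::finite \<Rightarrow> nat) \<Rightarrow> 'z pmf) \<Rightarrow> ('i \<Rightarrow> nat pmf) \<Rightarrow> 'z pmf" where
  "induced_lottery g lam = bind_pmf (Pi_pmf UNIV 0 lam) g"

definition MNE ::
  "('i::finite \<Rightarrow> nat set) \<Rightarrow> (('i \<Rightarrow> nat) \<Rightarrow> 'z::finite pmf) \<Rightarrow> ('i \<Rightarrow> 'z \<Rightarrow> real)
     \<Rightarrow> ('i \<Rightarrow> nat pmf) set" where
  "MNE M g u = {lam. (\<forall>i. set_pmf (lam i) \<subseteq> M i) \<and>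
      (\<forall>i \<mu>. set_pmf \<mu> \<subseteq> M i \<longrightarrow>
         exp_util (u i) (induced_lottery g (lam(i := \<mu>))) \<le> exp_util (u i) (induced_lottery g lam))}"

definition mixed_Nash_implementable ::
  "'s set \<Rightarrow> ('s \<Rightarrow> 'i::finite \<Rightarrow> 'z \<Rightarrow> 'z \<Rightarrow> bool) \<Rightarrow> ('s \<Rightarrow> 'z::finite) \<Rightarrow> real set \<Rightarrow> bool" where
  "mixed_Nash_implementable Theta pref f K \<longleftrightarrow>
     (\<exists>(M :: 'i \<Rightarrow> nat set) (g :: ('i \<Rightarrow> nat) \<Rightarrow> 'z pmf).
        (\<forall>i. M i \<noteq> {}) \<and>
        (\<forall>\<theta>\<in>Theta. \<forall>u\<in>cardinal_states (pref \<theta>) K.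
           (\<Union>lam\<in>MNE M g u. set_pmf (induced_lottery g lam)) = {f \<theta>}))"

end

theory Submission
  imports Defs
begin

text \<open>A mechanism for the reals also works for the rationals, so only the converse needs an argument.
  Take a mechanism for rational utilities, an equilibrium at one rational utility profile of a state
  \<open>\<theta>\<close>, and for each agent \<open>i\<close> the set \<open>S i\<close> of outcomes that unilateral deviations can produce.
  Since the equilibrium must break down at every rational utility profile of a state \<open>\<theta>'\<close> with
  \<open>f \<theta>' \<noteq> f \<theta>\<close>, in particular at one with huge losses below \<open>f \<theta>\<close>, some agent has a purely ordinal
  preference reversal inside \<open>S i\<close>. If moreover all of \<open>S i\<close> is top-ranked at \<open>\<theta>'\<close> by the agents
  other than \<open>i\<close>, and \<open>i\<close> is indifferent on it, then every deviation of \<open>i\<close> is an equilibrium at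
  \<open>\<theta>'\<close>, so \<open>S i = {f \<theta>'}\<close>.

  Conversely these ordinal data feed a canonical mechanism that copes with all real utilities. Agents
  report a state together with an integer \<open>n\<close>; a single dissenter \<open>i\<close> picks from a menu of lotteries
  on \<open>S i\<close> in which an outcome below \<open>f \<theta>\<close> may be mixed with weight of order \<open>1 / n\<close> on any other.
  For each real utility profile of \<open>\<theta>\<close> no such mixture is profitable once \<open>n\<close> is large, while a
  reversal yields a profitable one for every \<open>n\<close>. A vanishing chance of a uniform lottery is attached
  to dissent and to the integer game, so that these occur in equilibrium only under indifference.\<close>

section \<open>Expected utility\<close>

lemma exp_util_eq_expectation: "exp_util v y = measure_pmf.expectation y v"
  unfolding exp_util_def by (subst integral_measure_pmf_real[where A = UNIV]) (auto simp: mult.commute)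

lemma exp_util_return [simp]: "exp_util v (return_pmf z) = v z"
  by (simp add: exp_util_eq_expectation)

lemma abs_exp_util_le: "\<bar>exp_util v y\<bar> \<le> (\<Sum>z\<in>UNIV. \<bar>v z\<bar>)"
proof -
  have "\<bar>exp_util v y\<bar> \<le> (\<Sum>z\<in>UNIV. \<bar>pmf y z * v z\<bar>)"
    unfolding exp_util_def by (rule sum_abs)
  also have "\<dots> \<le> (\<Sum>z\<in>UNIV. \<bar>v z\<bar>)"
    by (intro sum_mono) (auto simp: abs_mult pmf_le_1 intro!: mult_left_le_one_le)
  finally show ?thesis .
qed

lemma integrable_exp_util [simp]: "integrable (measure_pmf p) (\<lambda>x. exp_util v (h x))"
  by (rule measure_pmf.integrable_const_bound[where B = "\<Sum>z\<in>UNIV. \<bar>v z\<bar>"])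
     (auto simp: abs_exp_util_le)

lemma exp_util_bind: "exp_util v (bind_pmf p h) = measure_pmf.expectation p (\<lambda>x. exp_util v (h x))"
proof -
  have "integrable (measure_pmf p) (\<lambda>x. pmf (h x) z)" for z
    by (rule measure_pmf.integrable_const_bound[where B = 1]) (auto simp: pmf_le_1)
  then show ?thesis
    by (simp add: exp_util_def pmf_bind)
qed

lemma expectation_le:
  fixes h :: "'a \<Rightarrow> real"
  assumes "integrable (measure_pmf p) h" and "\<And>x. x \<in> set_pmf p \<Longrightarrow> h x \<le> c"
  shows "measure_pmf.expectation p h \<le> c"
proof -
  have "measure_pmf.expectation p h \<le> measure_pmf.expectation p (\<lambda>_. c)"
    using assms by (intro integral_mono_AE) (auto simp: AE_measure_pmf_iff)
  then show ?thesis by simp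
qed

text \<open>The nonnegative variable \<open>c - h\<close> has mean zero, so it vanishes almost
  everywhere; each point of the support of a pmf has positive mass.\<close>

lemma expectation_eq_bound:
  fixes h :: "'a \<Rightarrow> real"
  assumes int: "integrable (measure_pmf p) h" and le: "\<And>x. x \<in> set_pmf p \<Longrightarrow> h x \<le> c"
    and ge: "c \<le> measure_pmf.expectation p h" and x: "x \<in> set_pmf p"
  shows "h x = c"
proof -
  have "measure_pmf.expectation p h = c"
    using expectation_le[OF int le] ge by simp
  then have "measure_pmf.expectation p (\<lambda>x. c - h x) = 0"
    using int by simp
  moreover have "AE x in measure_pmf p. 0 \<le> c - h x"
    using le by (auto simp: AE_measure_pmf_iff)
  ultimately have "AE x in measure_pmf p. c - h x = 0"
    using int by (subst (asm) integral_nonneg_eq_0_iff_AE) auto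
  then show ?thesis using x by (auto simp: AE_measure_pmf_iff)
qed

lemma exp_util_le:
  assumes "\<And>z. z \<in> set_pmf y \<Longrightarrow> v z \<le> c"
  shows "exp_util v y \<le> c"
  unfolding exp_util_eq_expectation
  by (rule expectation_le) (auto simp: assms intro: integrable_measure_pmf_finite)

lemma exp_util_eq_bound:
  assumes "\<And>z. z \<in> set_pmf y \<Longrightarrow> v z \<le> c" and "c \<le> exp_util v y" and "z \<in> set_pmf y"
  shows "v z = c"
  using assms unfolding exp_util_eq_expectation
  by (intro expectation_eq_bound[of y v c z]) (auto intro: integrable_measure_pmf_finite)

lemma exp_util_constant:
  assumes "\<And>z. z \<in> set_pmf y \<Longrightarrow> v z = c"
  shows "exp_util v y = c"
proof -
  have "measure_pmf.expectation y v = measure_pmf.expectation y (\<lambda>_. c)"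
    using assms by (intro integral_cong_AE) (auto simp: AE_measure_pmf_iff)
  then show ?thesis by (simp add: exp_util_eq_expectation)
qed

text \<open>The offset 2 keeps the weight of \<open>y0\<close> strictly between 0 and 1 even at
  \<open>k = 0\<close>, so both supports survive for every \<open>k\<close>, while the influence of
  \<open>y0\<close> vanishes as \<open>k\<close> grows.\<close>

definition blend :: "nat \<Rightarrow> 'z pmf \<Rightarrow> 'z pmf \<Rightarrow> 'z pmf" where
  "blend k y0 y = bind_pmf (bernoulli_pmf (1 / (real k + 2))) (\<lambda>b. if b then y0 else y)"

lemma set_blend [simp]: "set_pmf (blend k y0 y) = set_pmf y0 \<union> set_pmf y"
  by (auto simp: blend_def UNIV_bool split: if_splits)

lemma exp_util_blend:
  "exp_util v (blend k y0 y) = exp_util v y + (exp_util v y0 - exp_util v y) / (real k + 2)"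
  unfolding blend_def exp_util_bind
  by (subst integral_bernoulli_pmf) (auto simp: algebra_simps diff_divide_distrib)

lemma exp_util_blend_le:
  assumes "exp_util v y0 \<le> c" "exp_util v y \<le> c"
  shows "exp_util v (blend k y0 y) \<le> c"
  unfolding blend_def exp_util_bind using assms
  by (intro expectation_le) (auto intro: integrable_measure_pmf_finite)

text \<open>Since \<open>y0\<close> keeps positive weight, a blend that reaches a common upper bound
  forces \<open>y0\<close> to reach it as well.\<close>

lemma exp_util_blend_eq:
  assumes "exp_util v y0 \<le> c" "exp_util v y \<le> c" "c \<le> exp_util v (blend k y0 y)"
  shows "exp_util v y0 = c"
proof -
  have "(if True then exp_util v y0 else exp_util v y) = c"
  proof (rule expectation_eq_bound[where p = "bernoulli_pmf (1 / (real k + 2))"])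
    show "c \<le> measure_pmf.expectation (bernoulli_pmf (1 / (real k + 2)))
        (\<lambda>b. if b then exp_util v y0 else exp_util v y)"
      using assms(3) unfolding blend_def exp_util_bind if_distrib[of "exp_util v"] .
  qed (use assms in \<open>auto intro: integrable_measure_pmf_finite\<close>)
  then show ?thesis by simp
qed

lemma blend_tendsto: "(\<lambda>k. exp_util v (blend k y0 y)) \<longlonglongrightarrow> exp_util v y"
proof -
  have "(\<lambda>k. (exp_util v y0 - exp_util v y) / (real k + 2)) \<longlonglongrightarrow> 0"
    by (intro tendsto_divide_0[OF tendsto_const] filterlim_at_top_imp_at_infinity) real_asymp
  from tendsto_add[OF tendsto_const[of "exp_util v y"] this] show ?thesis
    by (simp add: exp_util_blend)
qed

section \<open>Pure deviations under a product distribution\<close>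

lemma Pi_pmf_update_return:
  "Pi_pmf UNIV d (lam(i := return_pmf x)) = map_pmf (\<lambda>m. m(i := x)) (Pi_pmf (UNIV :: 'i::finite set) d lam)"
proof -
  have ins: "Pi_pmf UNIV d l = map_pmf (\<lambda>(y, f). f(i := y)) (pair_pmf (l i) (Pi_pmf (UNIV - {i}) d l))"
    for l :: "'i \<Rightarrow> 'a pmf"
    using Pi_pmf_insert[of "UNIV - {i}" i d l] by (simp add: insert_absorb)
  have "Pi_pmf (UNIV - {i}) d (lam(i := return_pmf x)) = Pi_pmf (UNIV - {i}) d lam"
    by (intro Pi_pmf_cong) auto
  then show ?thesis
    by (subst (1 2) ins)
       (simp add: pair_return_pmf1 pmf.map_comp map_pair comp_def case_prod_unfold
          pair_pmf_def map_bind_pmf map_pmf_def bind_assoc_pmf bind_return_pmf)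
qed

text \<open>Overwriting coordinate \<open>i\<close> under the original distribution lets all pure
  deviations be compared profile by profile under one measure.\<close>

lemma induced_lottery_update_return:
  "induced_lottery g (lam(i := return_pmf x)) = bind_pmf (Pi_pmf UNIV 0 lam) (\<lambda>m. g (m(i := x)))"
  unfolding induced_lottery_def Pi_pmf_update_return by (simp add: bind_map_pmf)

section \<open>The canonical mechanism\<close>

text \<open>A message consists of a report (\<open>None\<close> for open dissent), an integer, a list naming for finitely
  many reports \<open>c\<close> the lottery wanted from the menu \<open>D c i\<close>, and the outcome wanted on winning the
  integer game.\<close>
type_synonym message = "nat option \<times> nat \<times> nat list \<times> nat"

text \<open>\<open>a c\<close> results from the unanimous report \<open>c\<close>;
  \<open>D c i\<close> is the menu open to \<open>i\<close> when all others report
  \<open>c\<close>.\<close>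

locale canonical_mechanism =
  fixes a :: "nat \<Rightarrow> 'z::finite" and D :: "nat \<Rightarrow> 'i::finite \<Rightarrow> 'z pmf set"
  assumes three_agents: "CARD('i) \<ge> 3"
    and finite_menu [simp]: "finite (D c i)"
    and status_quo_mem: "return_pmf (a c) \<in> D c i"
begin

definition report :: "nat \<Rightarrow> nat option" where
  "report x = fst (from_nat x :: message)"

definition rank :: "nat \<Rightarrow> nat" where
  "rank x = fst (snd (from_nat x :: message))"

definition choice :: "nat \<Rightarrow> nat \<Rightarrow> 'i \<Rightarrow> 'z pmf" where
  "choice x c i = (let l = fst (snd (snd (from_nat x :: message)))
     in from_nat_into (D c i) (if c < length l then l ! c else 0))"

definition wish :: "nat \<Rightarrow> 'z" where
  "wish x = from_nat_into UNIV (snd (snd (snd (from_nat x :: message))))"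

definition agree_except :: "'i \<Rightarrow> nat \<Rightarrow> ('i \<Rightarrow> nat) \<Rightarrow> bool" where
  "agree_except i c m \<longleftrightarrow> (\<forall>j. j \<noteq> i \<longrightarrow> report (m j) = Some c)"

text \<open>Its uniform weights make this mixture optimal only if all lotteries of the menu are
  equally good.\<close>

definition mean_menu :: "nat \<Rightarrow> 'i \<Rightarrow> 'z pmf" where
  "mean_menu c i = bind_pmf (pmf_of_set (D c i)) (\<lambda>y. y)"

definition challenge :: "nat \<Rightarrow> 'i \<Rightarrow> nat \<Rightarrow> 'z pmf" where
  "challenge c i x = blend (rank x) (mean_menu c i) (choice x c i)"

definition winner :: "('i \<Rightarrow> nat) \<Rightarrow> 'i" where
  "winner m = (SOME i. \<forall>j. rank (m j) \<le> rank (m i))"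

text \<open>Once consensus has failed, the pair picked by \<open>SOME\<close> is unique. Ties in
  \<open>winner\<close> are broken arbitrarily.\<close>

definition outcome :: "('i \<Rightarrow> nat) \<Rightarrow> 'z pmf" where
  "outcome m =
    (if \<exists>c. \<forall>j. report (m j) = Some c then return_pmf (a (THE c. \<forall>j. report (m j) = Some c))
     else if \<exists>i c. agree_except i c m
       then case (SOME (i, c). agree_except i c m) of (i, c) \<Rightarrow> challenge c i (m i)
     else blend (rank (m (winner m))) (pmf_of_set UNIV) (return_pmf (wish (m (winner m)))))"

section \<open>Evaluation of the outcome function\<close>

lemma D_nonempty [simp]: "D c i \<noteq> {}"
  using status_quo_mem by blast

lemma third_agent: "\<exists>l :: 'i. l \<noteq> i \<and> l \<noteq> j"
proof (rule ccontr)
  assume "\<not> ?thesis"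
  then have "(UNIV :: 'i set) \<subseteq> {i, j}" by auto
  then have "CARD('i) \<le> card {i, j}" by (intro card_mono) auto
  also have "\<dots> \<le> 2" by (simp add: card_insert_if)
  finally show False using three_agents by simp
qed

text \<open>Among three agents someone differs from both \<open>i\<close> and \<open>j\<close>, and
  that agent reports \<open>c\<close> as well as \<open>c'\<close>.\<close>

lemma agree_except_unique_report:
  assumes "agree_except i c m" "agree_except j c' m"
  shows "c = c'"
proof -
  obtain l where "l \<noteq> i" "l \<noteq> j" using third_agent by blast
  with assms show ?thesis unfolding agree_except_def by (metis option.inject)
qed

lemma agree_except_unique_agent:
  assumes "agree_except i c m" "agree_except j c' m" "report (m i) \<noteq> Some c"
  shows "i = j"
  using assms agree_except_unique_report[OF assms(1,2)] unfolding agree_except_def by metis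

lemma outcome_consensus:
  assumes "\<And>j. report (m j) = Some c"
  shows "outcome m = return_pmf (a c)"
  using assms by (auto simp: outcome_def)

lemma outcome_challenge:
  assumes "agree_except i c m" "report (m i) \<noteq> Some c"
  shows "outcome m = challenge c i (m i)"
proof -
  have "\<not> (\<exists>c. \<forall>j. report (m j) = Some c)"
  proof
    assume "\<exists>c. \<forall>j. report (m j) = Some c"
    then obtain c' where c': "\<And>j. report (m j) = Some c'" by blast
    then have "agree_except i c' m" by (simp add: agree_except_def)
    with agree_except_unique_report[OF assms(1)] c' assms(2) show False by metis
  qed
  moreover have "(SOME (i, c). agree_except i c m) = (i, c)"
  proof (rule some_equality)
    fix p assume "case p of (j, c') \<Rightarrow> agree_except j c' m"
    then show "p = (i, c)"
      using agree_except_unique_agent[OF assms(1) _ assms(2)] agree_except_unique_report[OF assms(1)]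
      by (cases p) auto
  qed (simp add: assms)
  moreover have "\<exists>i c. agree_except i c m" using assms(1) by blast
  ultimately show ?thesis by (simp only: outcome_def if_True if_False prod.case)
qed

lemma outcome_game:
  assumes "\<And>i c. \<not> agree_except i c m"
  shows "outcome m = blend (rank (m (winner m))) (pmf_of_set UNIV) (return_pmf (wish (m (winner m))))"
proof -
  have "\<not> (\<exists>c. \<forall>j. report (m j) = Some c)"
    using assms unfolding agree_except_def by metis
  with assms show ?thesis by (auto simp: outcome_def)
qed

lemma winner_eq:
  assumes "\<And>j. j \<noteq> i \<Longrightarrow> rank (m j) < rank (m i)"
  shows "winner m = i"
  unfolding winner_def
proof (rule some_equality)
  show "\<forall>j. rank (m j) \<le> rank (m i)"
    using assms by (metis less_imp_le order_refl)
  show "i' = i" if "\<forall>j. rank (m j) \<le> rank (m i')" for i'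
    using assms[of i'] that by (meson leD)
qed

section \<open>Values of best replies\<close>

definition best :: "('z \<Rightarrow> real) \<Rightarrow> 'i \<Rightarrow> ('i \<Rightarrow> nat) \<Rightarrow> real" where
  "best v i m = (if \<exists>c. agree_except i c m
     then Max (exp_util v ` D (THE c. agree_except i c m) i) else Max (range v))"

lemma best_agree:
  assumes "agree_except i c m"
  shows "best v i m = Max (exp_util v ` D c i)"
proof -
  have "(THE c. agree_except i c m) = c"
    using assms agree_except_unique_report[OF assms] by blast
  with assms show ?thesis by (auto simp: best_def)
qed

lemma set_mean_menu [simp]: "set_pmf (mean_menu c i) = (\<Union>y\<in>D c i. set_pmf y)"
  by (auto simp: mean_menu_def)

lemma exp_util_mean_menu_le: "exp_util v (mean_menu c i) \<le> Max (exp_util v ` D c i)"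
  unfolding mean_menu_def exp_util_bind by (intro expectation_le) auto

lemma exp_util_mean_menu_eq:
  assumes "Max (exp_util v ` D c i) \<le> exp_util v (mean_menu c i)" "y \<in> D c i"
  shows "exp_util v y = Max (exp_util v ` D c i)"
  using assms unfolding mean_menu_def exp_util_bind
  by (intro expectation_eq_bound[where h = "exp_util v" and p = "pmf_of_set (D c i)"])
     (auto intro: integrable_measure_pmf_finite)

lemma choice_mem: "choice x c i \<in> D c i"
  by (simp add: choice_def from_nat_into Let_def)

text \<open>Together with \<open>best_approximable\<close> this makes \<open>best v i m\<close> the
  supremum of what \<open>i\<close> can reach against the messages of the others; it does not depend
  on \<open>m i\<close>.\<close>

lemma exp_util_outcome_le: "exp_util v (outcome m) \<le> best v i m"
proof (cases "\<exists>c. agree_except i c m")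
  case True
  then obtain c where c: "agree_except i c m" by blast
  show ?thesis
  proof (cases "report (m i) = Some c")
    case True
    then have "report (m j) = Some c" for j
      using c by (cases "j = i") (auto simp: agree_except_def)
    then have "outcome m = return_pmf (a c)" by (rule outcome_consensus)
    then show ?thesis using status_quo_mem[of c i] by (simp add: best_agree[OF c] del: exp_util_return)
  next
    case False
    then show ?thesis
      by (simp add: outcome_challenge[OF c] best_agree[OF c] challenge_def choice_mem
          exp_util_blend_le exp_util_mean_menu_le)
  qed
next
  case False
  then show ?thesis by (auto simp: best_def intro: exp_util_le)
qed

text \<open>The limit is needed because no single message is an exact best reply: the integer must
  exceed those of the opponents, and only finitely many menus can be named.\<close>
lemma best_approximable:
  "\<exists>x :: nat \<Rightarrow> nat. \<forall>m. (\<lambda>k. exp_util v (outcome (m(i := x k)))) \<longlonglongrightarrow> best v i m"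
proof -
  have "\<exists>y\<in>D c i. exp_util v y = Max (exp_util v ` D c i)" for c
  proof -
    have "Max (exp_util v ` D c i) \<in> exp_util v ` D c i" by (intro Max_in) auto
    then show ?thesis by (metis imageE)
  qed
  then have "\<exists>n. exp_util v (from_nat_into (D c i) n) = Max (exp_util v ` D c i)" for c
    using subset_range_from_nat_into[of "D c i"] by (metis finite_menu countable_finite rangeE subsetD)
  then obtain p where p: "\<And>c. exp_util v (from_nat_into (D c i) (p c)) = Max (exp_util v ` D c i)"
    by metis
  have "Max (range v) \<in> range v" by (intro Max_in) auto
  then obtain z where z: "v z = Max (range v)" by (metis rangeE)
  obtain w where w: "from_nat_into (UNIV :: 'z set) w = z"
    using subset_range_from_nat_into[of "UNIV :: 'z set"] by (metis UNIV_I countable_finite finite rangeE subsetD)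
  \<comment> \<open>Agent \<open>i\<close> dissents openly, bids the integer \<open>k\<close>, names
    an optimal lottery for each of the first \<open>k\<close> reports and wishes for a top
    outcome.\<close>
  define x where "x k = to_nat ((None, k, map p [0..<k], w) :: message)" for k
  have x: "report (x k) = None" "rank (x k) = k" "wish (x k) = z" for k
    by (auto simp: x_def report_def rank_def wish_def w)
  have choice_x: "choice (x k) c i = from_nat_into (D c i) (p c)" if "c < k" for k c
    using that by (simp add: x_def choice_def)
  show ?thesis
  proof (intro exI[of _ x] allI)
    fix m
    show "(\<lambda>k. exp_util v (outcome (m(i := x k)))) \<longlonglongrightarrow> best v i m"
    proof (cases "\<exists>c. agree_except i c m")
      case True
      then obtain c where c: "agree_except i c m" by blast
      have "exp_util v (outcome (m(i := x k)))
          = exp_util v (blend k (mean_menu c i) (from_nat_into (D c i) (p c)))" if "k > c" for k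
      proof -
        have "agree_except i c (m(i := x k))" using c by (simp add: agree_except_def)
        then have "outcome (m(i := x k)) = challenge c i ((m(i := x k)) i)"
          by (rule outcome_challenge) (simp add: x)
        then show ?thesis using that by (simp add: challenge_def x choice_x)
      qed
      then have "\<forall>\<^sub>F k in sequentially. exp_util v (blend k (mean_menu c i) (from_nat_into (D c i) (p c)))
          = exp_util v (outcome (m(i := x k)))"
        by (intro eventually_mono[OF eventually_gt_at_top[of c]]) simp
      from Lim_transform_eventually[OF blend_tendsto this] show ?thesis
        by (simp add: best_agree[OF c] p)
    next
      case False
      have "exp_util v (outcome (m(i := x k)))
          = exp_util v (blend k (pmf_of_set UNIV) (return_pmf z))" if "k > Max (range (\<lambda>j. rank (m j)))" for k
      proof -
        \<comment> \<open>The report \<open>None\<close> rules out agreement of all but some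
          \<open>j\<close> other than \<open>i\<close>; agreement of all but \<open>i\<close> is
          excluded by the case.\<close>
        have game: "\<not> agree_except j c (m(i := x k))" for j c
        proof
          assume agr: "agree_except j c (m(i := x k))"
          then have "i = j" unfolding agree_except_def by (metis fun_upd_same option.distinct(1) x(1))
          then show False using agr False by (auto simp: agree_except_def)
        qed
        have "rank (m j) < k" for j
          using that by (meson Max_ge finite_imageI finite rangeI le_less_trans)
        then have "winner (m(i := x k)) = i"
          by (intro winner_eq) (simp add: x)
        then show ?thesis by (simp add: outcome_game[OF game] x)
      qed
      then have "\<forall>\<^sub>F k in sequentially. exp_util v (blend k (pmf_of_set UNIV) (return_pmf z))
          = exp_util v (outcome (m(i := x k)))"
        by (intro eventually_mono[OF eventually_gt_at_top[of "Max (range (\<lambda>j. rank (m j)))"]]) simp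
      from Lim_transform_eventually[OF blend_tendsto this] False show ?thesis
        by (simp add: best_def z)
    qed
  qed
qed

text \<open>One sequence of messages approximates \<open>best\<close> against all opposing profiles
  at once. By dominated convergence the equilibrium payoff is at least the mean of
  \<open>best\<close>, and the pointwise upper bound then forces equality on the support.\<close>

lemma equilibrium_attains_best:
  assumes eq: "lam \<in> MNE (\<lambda>_. UNIV) outcome u" and m: "m \<in> set_pmf (Pi_pmf UNIV 0 lam)"
  shows "exp_util (u i) (outcome m) = best (u i) i m"
proof -
  let ?P = "Pi_pmf UNIV 0 lam"
  define B where "B = (\<Sum>z\<in>UNIV. \<bar>u i z\<bar>)"
  obtain x where x: "\<And>m. (\<lambda>k. exp_util (u i) (outcome (m(i := x k)))) \<longlonglongrightarrow> best (u i) i m"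
    using best_approximable by blast
  have "\<bar>best (u i) i m\<bar> \<le> B" for m
    by (rule LIMSEQ_le_const2[OF tendsto_rabs[OF x]]) (auto simp: B_def abs_exp_util_le)
  then have int: "integrable (measure_pmf ?P) (\<lambda>m. best (u i) i m)"
    by (intro measure_pmf.integrable_const_bound[where B = B]) auto
  have "(\<lambda>k. measure_pmf.expectation ?P (\<lambda>m. exp_util (u i) (outcome (m(i := x k)))))
      \<longlonglongrightarrow> measure_pmf.expectation ?P (best (u i) i)"
    by (rule integral_dominated_convergence[where w = "\<lambda>_. B"]) (auto simp: x B_def abs_exp_util_le)
  moreover have "measure_pmf.expectation ?P (\<lambda>m. exp_util (u i) (outcome (m(i := x k))))
      \<le> measure_pmf.expectation ?P (\<lambda>m. exp_util (u i) (outcome m))" for k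
  proof -
    have "exp_util (u i) (induced_lottery outcome (lam(i := return_pmf (x k))))
        \<le> exp_util (u i) (induced_lottery outcome lam)"
      using eq by (auto simp: MNE_def)
    then show ?thesis
      unfolding induced_lottery_update_return by (simp add: exp_util_bind induced_lottery_def)
  qed
  ultimately have "measure_pmf.expectation ?P (best (u i) i)
      \<le> measure_pmf.expectation ?P (\<lambda>m. exp_util (u i) (outcome m))"
    by (intro LIMSEQ_le_const2) auto
  then have "exp_util (u i) (outcome m) - best (u i) i m = 0"
    using int m exp_util_outcome_le
    by (intro expectation_eq_bound[where p = ?P]) (auto simp: int)
  then show ?thesis by simp
qed

text \<open>A unilateral deviation leaves the others at \<open>c\<close>, so \<open>best\<close>
  caps its value by the menu \<open>D c i\<close>, on which \<open>a c\<close> is optimal.\<close>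

lemma consensus_equilibrium:
  assumes opt: "\<And>i y. y \<in> D c i \<Longrightarrow> exp_util (u i) y \<le> u i (a c)"
  shows "\<exists>lam\<in>MNE (\<lambda>_. UNIV) outcome u. induced_lottery outcome lam = return_pmf (a c)"
proof -
  define x where "x = to_nat ((Some c, 0, [], 0) :: message)"
  have x: "report x = Some c" by (simp add: x_def report_def)
  define lam where "lam = (\<lambda>_ :: 'i. return_pmf x)"
  have ind: "induced_lottery outcome lam = return_pmf (a c)"
    by (simp add: induced_lottery_def lam_def bind_return_pmf outcome_consensus x)
  moreover have "lam \<in> MNE (\<lambda>_. UNIV) outcome u"
  proof -
    have "exp_util (u i) (induced_lottery outcome (lam(i := \<mu>))) \<le> u i (a c)" for i \<mu>
      unfolding induced_lottery_def exp_util_bind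
    proof (rule expectation_le)
      fix m assume "m \<in> set_pmf (Pi_pmf UNIV 0 (lam(i := \<mu>)))"
      then have "m j \<in> set_pmf ((lam(i := \<mu>)) j)" for j
        by (simp add: set_Pi_pmf PiE_dflt_def)
      then have "m j = x" if "j \<noteq> i" for j
        using that by (metis fun_upd_other lam_def set_return_pmf singletonD)
      then have "agree_except i c m" by (simp add: agree_except_def x)
      then have "best (u i) i m = Max (exp_util (u i) ` D c i)" by (rule best_agree)
      also have "\<dots> \<le> u i (a c)" using opt by simp
      finally show "exp_util (u i) (outcome m) \<le> u i (a c)"
        using exp_util_outcome_le order_trans by blast
    qed simp
    then show ?thesis by (simp add: MNE_def ind)
  qed
  ultimately show ?thesis by blast
qed

text \<open>The cases follow a message profile in the support with \<open>z\<close> among its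
  outcomes. The blends give a challenge the support of the whole menu and the integer game that of
  all outcomes, so optimality spreads to all of these.\<close>

lemma equilibrium_cases:
  assumes eq: "lam \<in> MNE (\<lambda>_. UNIV) outcome u"
    and z: "z \<in> set_pmf (induced_lottery outcome lam)"
  obtains (consensus) c where "z = a c" "\<And>i y. y \<in> D c i \<Longrightarrow> exp_util (u i) y \<le> u i (a c)"
  | (challenge) c i where "z \<in> (\<Union>y\<in>D c i. set_pmf y)"
      "\<And>j w w'. j \<noteq> i \<Longrightarrow> w \<in> (\<Union>y\<in>D c i. set_pmf y) \<Longrightarrow> u j w' \<le> u j w"
      "\<And>y y'. y \<in> D c i \<Longrightarrow> y' \<in> D c i \<Longrightarrow> exp_util (u i) y = exp_util (u i) y'"
  | (indifference) "\<And>i w w'. u i w = u i w'"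
proof -
  obtain m where m: "m \<in> set_pmf (Pi_pmf UNIV 0 lam)" and zm: "z \<in> set_pmf (outcome m)"
    using z by (auto simp: induced_lottery_def)
  note best = equilibrium_attains_best[OF eq m]
  \<comment> \<open>If the others do not agree, \<open>j\<close> can win the integer game, so every
    outcome in the support must have maximal utility for \<open>j\<close>.\<close>
  have top: "u j w' \<le> u j w" if "\<And>c. \<not> agree_except j c m" "w \<in> set_pmf (outcome m)" for j w w'
  proof -
    have "exp_util (u j) (outcome m) = Max (range (u j))"
      using that best[of j] by (simp add: best_def)
    then have "u j w = Max (range (u j))"
      using that by (intro exp_util_eq_bound[where y = "outcome m"]) auto
    then show ?thesis by simp
  qed
  show thesis
  proof (cases "\<exists>i c. agree_except i c m")
    case True
    then obtain i c where ic: "agree_except i c m" by blast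
    show thesis
    proof (cases "report (m i) = Some c")
      case True
      then have rep: "report (m j) = Some c" for j
        using ic by (cases "j = i") (auto simp: agree_except_def)
      then have out: "outcome m = return_pmf (a c)" by (rule outcome_consensus)
      show thesis
      proof (rule consensus)
        show "z = a c" using zm out by simp
        fix j y assume y: "y \<in> D c j"
        have "agree_except j c m" by (simp add: agree_except_def rep)
        from best_agree[OF this] best[of j] out have "u j (a c) = Max (exp_util (u j) ` D c j)" by simp
        then show "exp_util (u j) y \<le> u j (a c)" using y by simp
      qed
    next
      case False
      have out: "outcome m = blend (rank (m i)) (mean_menu c i) (choice (m i) c i)"
        using outcome_challenge[OF ic False] by (simp add: challenge_def)
      show thesis
      proof (rule challenge)
        show "z \<in> (\<Union>y\<in>D c i. set_pmf y)" using zm choice_mem by (auto simp: out)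
        show "u j w' \<le> u j w" if "j \<noteq> i" "w \<in> (\<Union>y\<in>D c i. set_pmf y)" for j w w'
          using that agree_except_unique_agent[OF ic _ False] by (intro top) (auto simp: out)
        have "exp_util (u i) (mean_menu c i) = Max (exp_util (u i) ` D c i)"
          using best[of i] by (intro exp_util_blend_eq[where y = "choice (m i) c i" and k = "rank (m i)"])
            (auto simp: best_agree[OF ic] out choice_mem exp_util_mean_menu_le)
        then have "exp_util (u i) y = Max (exp_util (u i) ` D c i)" if "y \<in> D c i" for y
          using that by (intro exp_util_mean_menu_eq) auto
        then show "exp_util (u i) y = exp_util (u i) y'" if "y \<in> D c i" "y' \<in> D c i" for y y'
          using that by metis
      qed
    qed
  next
    case False
    then have "set_pmf (outcome m) = UNIV" by (simp add: outcome_game)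
    with False have "u i w' \<le> u i w" for i w w' by (intro top) auto
    then show thesis by (intro indifference) (simp add: order_antisym)
  qed
qed

end

section \<open>Ordinal data of an equilibrium\<close>

definition represents :: "('z \<Rightarrow> real) \<Rightarrow> ('z \<Rightarrow> 'z \<Rightarrow> bool) \<Rightarrow> bool" where
  "represents v R \<longleftrightarrow> (\<forall>z z'. R z z' \<longleftrightarrow> v z \<ge> v z')"

lemma cardinal_states_iff:
  "u \<in> cardinal_states P K \<longleftrightarrow> (\<forall>i. represents (u i) (P i)) \<and> (\<forall>i z. u i z \<in> K)"
  by (auto simp: cardinal_states_def represents_def)

text \<open>Being integer-valued, this representation turns strict preference into a gap of at least
  one, and no gap exceeds \<open>CARD('z)\<close>.\<close>

definition rank_util :: "('z::finite \<Rightarrow> 'z \<Rightarrow> bool) \<Rightarrow> 'z \<Rightarrow> real" where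
  "rank_util R z = real (card {w. R z w})"

lemma represents_rank_util:
  assumes "complete_preorder R"
  shows "represents (rank_util R) R"
  unfolding represents_def
proof (intro allI)
  fix z z'
  have total: "R x y \<or> R y x" for x y using assms by (auto simp: complete_preorder_def)
  have trans: "R x w" if "R x y" "R y w" for x y w
    using assms that by (auto simp: complete_preorder_def)
  show "R z z' \<longleftrightarrow> rank_util R z \<ge> rank_util R z'"
  proof
    assume "R z z'"
    then show "rank_util R z \<ge> rank_util R z'"
      unfolding rank_util_def of_nat_le_iff by (intro card_mono) (auto intro: trans)
  next
    assume le: "rank_util R z \<ge> rank_util R z'"
    show "R z z'"
    proof (rule ccontr)
      assume "\<not> R z z'"
      then have "{w. R z w} \<subset> {w. R z' w}" using total trans by blast
      then have "card {w. R z w} < card {w. R z' w}" by (intro psubset_card_mono) auto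
      with le show False by (simp add: rank_util_def)
    qed
  qed
qed

lemma rank_util_bounds: "0 \<le> rank_util R z" "rank_util R z \<le> real CARD('z)" for z :: "'z::finite"
  by (auto simp: rank_util_def intro: card_mono)

lemma rank_util_less_imp_gap:
  assumes "rank_util R z < rank_util R z'"
  shows "rank_util R z + 1 \<le> rank_util R z'"
  using assms by (simp add: rank_util_def)

text \<open>The factor \<open>CARD('z) ^ 2\<close> makes any loss below \<open>b\<close> at least
  \<open>CARD('z)\<close> times the largest possible rank gap.\<close>

definition steep_util :: "('z::finite \<Rightarrow> 'z \<Rightarrow> bool) \<Rightarrow> 'z \<Rightarrow> 'z \<Rightarrow> real" where
  "steep_util R b z = (let d = rank_util R z - rank_util R b
     in if d \<ge> 0 then d else real CARD('z) ^ 2 * d)"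

lemma represents_steep_util:
  fixes b :: "'z::finite"
  assumes "complete_preorder R"
  shows "represents (steep_util R b) R"
proof -
  define C where "C = real CARD('z) ^ 2"
  have C: "C > 0" by (simp add: C_def)
  have "steep_util R b z \<ge> steep_util R b z' \<longleftrightarrow> rank_util R z \<ge> rank_util R z'" for z z'
  proof -
    have "x \<le> y \<longleftrightarrow> (if x \<ge> 0 then x else C * x) \<le> (if y \<ge> 0 then y else C * y)" for x y
      using C by (smt (verit) mult_le_cancel_left_pos mult_pos_neg)
    from this[of "rank_util R z' - rank_util R b" "rank_util R z - rank_util R b"]
    show ?thesis unfolding steep_util_def Let_def C_def diff_le_eq diff_add_cancel by (simp only:)
  qed
  then show ?thesis using represents_rank_util[OF assms] by (simp add: represents_def)
qed

lemma Rats_rank_util: "rank_util R z \<in> \<rat>"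
  by (simp add: rank_util_def)

lemma Rats_steep_util: "steep_util R b z \<in> \<rat>"
  by (auto simp: steep_util_def Let_def Rats_rank_util intro!: Rats_diff Rats_mult)

text \<open>Preference \<open>R'\<close> overturns the optimality of \<open>b\<close> under \<open>R\<close> on lotteries over \<open>S\<close>: either some outcome
  moves above \<open>b\<close>, or some outcome strictly below \<open>b\<close> rises to the level of \<open>b\<close> and can then be mixed
  with a little of an outcome above \<open>b\<close>.\<close>
definition reversal :: "('z \<Rightarrow> 'z \<Rightarrow> bool) \<Rightarrow> ('z \<Rightarrow> 'z \<Rightarrow> bool) \<Rightarrow> 'z \<Rightarrow> 'z set \<Rightarrow> bool" where
  "reversal R R' b S \<longleftrightarrow> (\<exists>z\<in>S. R b z \<and> \<not> R' b z) \<or>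
     ((\<exists>z\<in>S. \<not> R z b \<and> R' z b) \<and> (\<exists>z\<in>S. \<not> R' b z))"

lemma exp_util_mono:
  assumes "\<And>z. z \<in> set_pmf y \<Longrightarrow> v z \<le> v' z"
  shows "exp_util v y \<le> exp_util v' y"
  unfolding exp_util_def
proof (rule sum_mono)
  fix z show "pmf y z * v z \<le> pmf y z * v' z"
    using assms[of z] by (cases "z \<in> set_pmf y") (auto intro: mult_left_mono simp: set_pmf_iff)
qed

text \<open>Without a reversal, \<open>steep_util\<close> is dominated by a positive multiple of \<open>rank_util\<close>
  when both are normalised at \<open>b\<close>, so the lower contour sets of lotteries are nested.\<close>
lemma steep_util_no_gain:
  fixes b :: "'z::finite"
  assumes R: "complete_preorder R" and R': "complete_preorder R'"
    and no: "\<not> reversal R R' b S" and S: "set_pmf y \<subseteq> S"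
    and le: "exp_util (rank_util R) y \<le> rank_util R b"
  shows "exp_util (steep_util R' b) y \<le> steep_util R' b b"
proof -
  let ?C = "real CARD('z)"
  have C: "?C \<ge> 1" using one_le_card_finite[where 'a='z] by linarith
  have r: "R z z' \<longleftrightarrow> rank_util R z \<ge> rank_util R z'" for z z'
    using represents_rank_util[OF R] by (simp add: represents_def)
  have r': "R' z z' \<longleftrightarrow> rank_util R' z \<ge> rank_util R' z'" for z z'
    using represents_rank_util[OF R'] by (simp add: represents_def)
  have b: "steep_util R' b b = 0" by (simp add: steep_util_def)
  have s: "R' b z \<longleftrightarrow> steep_util R' b z \<le> 0" for z
    using represents_steep_util[OF R', of b] by (simp add: represents_def b)
  show ?thesis
  proof (cases "\<forall>z\<in>S. R' b z")
    case True
    with S s show ?thesis unfolding b by (intro exp_util_le) auto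
  next
    \<comment> \<open>Some outcome of \<open>S\<close> now lies above \<open>b\<close>, so excluding
      the second kind of reversal keeps everything strictly below \<open>b\<close> under
      \<open>R\<close> strictly below it under \<open>R'\<close>.\<close>
    case False
    have "steep_util R' b z \<le> ?C * (rank_util R z - rank_util R b)" if z: "z \<in> S" for z
    proof (cases "rank_util R z" "rank_util R b" rule: linorder_cases)
      case less
      then have "\<not> R' z b" using no z False r[of z b] by (auto simp: reversal_def)
      then have d: "rank_util R' z - rank_util R' b \<le> -1"
        using rank_util_less_imp_gap[of R' z b] r'[of z b] by simp
      then have "steep_util R' b z = ?C ^ 2 * (rank_util R' z - rank_util R' b)"
        by (simp add: steep_util_def)
      also have "\<dots> \<le> ?C ^ 2 * (-1)" using d by (intro mult_left_mono) auto
      also have "\<dots> = ?C * (- ?C)" by (simp add: power2_eq_square)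
      also have "\<dots> \<le> ?C * (rank_util R z - rank_util R b)"
        using rank_util_bounds(1)[of R z] rank_util_bounds(2)[of R b] by (intro mult_left_mono) auto
      finally show ?thesis .
    next
      case equal
      then have "R' b z" using no z r[of b z] by (auto simp: reversal_def)
      with equal s show ?thesis by simp
    next
      case greater
      have "steep_util R' b z \<le> ?C"
      proof (cases "R' b z")
        case True then show ?thesis using s C by fastforce
      next
        case False
        then show ?thesis using rank_util_bounds(1)[of R' b] rank_util_bounds(2)[of R' z] r'[of b z]
          by (simp add: steep_util_def)
      qed
      also have "?C \<le> ?C * (rank_util R z - rank_util R b)"
        using rank_util_less_imp_gap[OF greater] C by simp
      finally show ?thesis .
    qed
    then have "exp_util (steep_util R' b) y \<le> exp_util (\<lambda>z. ?C * (rank_util R z - rank_util R b)) y"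
      using S by (intro exp_util_mono) auto
    also have "\<dots> = ?C * (exp_util (rank_util R) y - rank_util R b)"
      by (simp add: exp_util_eq_expectation integrable_measure_pmf_finite)
    also have "\<dots> \<le> 0" using le by (simp add: mult_nonneg_nonpos)
    finally show ?thesis by (simp add: b)
  qed
qed

section \<open>Ordinal conditions extracted from an equilibrium\<close>

definition deviation_support ::
  "'s set \<Rightarrow> ('s \<Rightarrow> 'i \<Rightarrow> 'z \<Rightarrow> 'z \<Rightarrow> bool) \<Rightarrow> ('s \<Rightarrow> 'z) \<Rightarrow> 's \<Rightarrow> ('i \<Rightarrow> 'z set) \<Rightarrow> bool" where
  "deviation_support Theta pref f \<theta> S \<longleftrightarrow>
     (\<forall>i. f \<theta> \<in> S i) \<and>
     (\<forall>i. (\<exists>z\<in>S i. \<not> pref \<theta> i z (f \<theta>)) \<or> (\<forall>z\<in>S i. pref \<theta> i (f \<theta>) z)) \<and>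
     (\<forall>\<theta>'\<in>Theta. f \<theta>' \<noteq> f \<theta> \<longrightarrow> (\<exists>i. reversal (pref \<theta> i) (pref \<theta>' i) (f \<theta>) (S i))) \<and>
     (\<forall>\<theta>'\<in>Theta. \<forall>i. (\<forall>j z z'. j \<noteq> i \<longrightarrow> z \<in> S i \<longrightarrow> pref \<theta>' j z z') \<longrightarrow>
        (\<forall>z\<in>S i. \<forall>z'\<in>S i. pref \<theta>' i z z') \<longrightarrow> S i \<subseteq> {f \<theta>'})"

lemma ex_deviation_support:
  fixes pref :: "'s \<Rightarrow> 'i::finite \<Rightarrow> 'z::finite \<Rightarrow> 'z \<Rightarrow> bool"
  assumes impl: "mixed_Nash_implementable Theta pref f \<rat>"
    and pre: "\<And>\<theta> i. \<theta> \<in> Theta \<Longrightarrow> complete_preorder (pref \<theta> i)"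
    and th: "\<theta> \<in> Theta"
  shows "\<exists>S. deviation_support Theta pref f \<theta> S"
proof -
  obtain M :: "'i \<Rightarrow> nat set" and g where
    impl: "\<And>\<theta> u. \<theta> \<in> Theta \<Longrightarrow> u \<in> cardinal_states (pref \<theta>) \<rat> \<Longrightarrow>
      (\<Union>lam\<in>MNE M g u. set_pmf (induced_lottery g lam)) = {f \<theta>}"
    using impl unfolding mixed_Nash_implementable_def by blast
  define rk where "rk \<theta> i = rank_util (pref \<theta> i)" for \<theta> i
  have rk: "rk \<theta> \<in> cardinal_states (pref \<theta>) \<rat>" if "\<theta> \<in> Theta" for \<theta>
    using that pre by (simp add: cardinal_states_iff rk_def represents_rank_util Rats_rank_util)
  have rep: "pref \<theta> i z z' \<longleftrightarrow> rk \<theta> i z \<ge> rk \<theta> i z'" if "\<theta> \<in> Theta" for \<theta> i z z'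
    using rk[OF that] by (simp add: cardinal_states_def)
  \<comment> \<open>The supports of all equilibrium lotteries unite to a singleton, so each of these
    lotteries is degenerate.\<close>
  have unique: "induced_lottery g lam = return_pmf (f \<theta>)"
    if "\<theta> \<in> Theta" "u \<in> cardinal_states (pref \<theta>) \<rat>" "lam \<in> MNE M g u" for \<theta> u lam
    using impl[OF that(1,2)] that(3) by (intro set_pmf_subset_singleton[THEN iffD1]) auto
  obtain lam where lam: "lam \<in> MNE M g (rk \<theta>)"
    using impl[OF th rk[OF th]] by auto
  have ind: "induced_lottery g lam = return_pmf (f \<theta>)" by (rule unique[OF th rk[OF th] lam])
  have supp: "set_pmf (lam i) \<subseteq> M i" for i using lam by (simp add: MNE_def)
  define S where "S i = (\<Union>\<mu>\<in>{\<mu>. set_pmf \<mu> \<subseteq> M i}. set_pmf (induced_lottery g (lam(i := \<mu>))))" for i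
  have dev_le: "exp_util (rk \<theta> i) (induced_lottery g (lam(i := \<mu>))) \<le> rk \<theta> i (f \<theta>)"
    if "set_pmf \<mu> \<subseteq> M i" for i \<mu>
    using lam that by (auto simp: MNE_def ind)
  have "deviation_support Theta pref f \<theta> S"
    unfolding deviation_support_def
  proof (intro conjI allI ballI impI)
    show "f \<theta> \<in> S i" for i
      unfolding S_def using supp[of i] ind by (auto intro!: exI[of _ "lam i"])
    show "(\<exists>z\<in>S i. \<not> pref \<theta> i z (f \<theta>)) \<or> (\<forall>z\<in>S i. pref \<theta> i (f \<theta>) z)" for i
    proof (rule disjCI)
      assume "\<not> (\<forall>z\<in>S i. pref \<theta> i (f \<theta>) z)"
      then obtain \<mu> z where mu: "set_pmf \<mu> \<subseteq> M i" and z: "z \<in> set_pmf (induced_lottery g (lam(i := \<mu>)))"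
        and gt: "rk \<theta> i z > rk \<theta> i (f \<theta>)"
        by (auto simp: S_def rep[OF th] not_le)
      show "\<exists>z\<in>S i. \<not> pref \<theta> i z (f \<theta>)"
      proof (rule ccontr)
        assume "\<not> ?thesis"
        then have ge: "rk \<theta> i (f \<theta>) \<le> rk \<theta> i w" if "w \<in> set_pmf (induced_lottery g (lam(i := \<mu>)))" for w
          using that mu by (auto simp: S_def rep[OF th])
        \<comment> \<open>A deviation with no outcome worse than \<open>f \<theta>\<close> cannot
          contain a better one, or it would pay; negation turns the lower bound into an upper
          one.\<close>
        have "- rk \<theta> i z = - rk \<theta> i (f \<theta>)"
          using ge dev_le[OF mu] z
          by (intro exp_util_eq_bound[where v = "\<lambda>z. - rk \<theta> i z" and y = "induced_lottery g (lam(i := \<mu>))"])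
             (auto simp: exp_util_def sum_negf)
        with gt show False by simp
      qed
    qed
    show "\<exists>i. reversal (pref \<theta> i) (pref \<theta>' i) (f \<theta>) (S i)" if th': "\<theta>' \<in> Theta" and ne: "f \<theta>' \<noteq> f \<theta>" for \<theta>'
    proof (rule ccontr)
      assume no: "\<not> ?thesis"
      \<comment> \<open>Without reversals \<open>lam\<close> would survive as an equilibrium at
        these rational utilities of \<open>\<theta>'\<close>.\<close>
      let ?u = "\<lambda>i. steep_util (pref \<theta>' i) (f \<theta>)"
      have u: "?u \<in> cardinal_states (pref \<theta>') \<rat>"
        using pre[OF th'] by (simp add: cardinal_states_iff represents_steep_util Rats_steep_util)
      have "exp_util (?u i) (induced_lottery g (lam(i := \<mu>))) \<le> ?u i (f \<theta>)" if "set_pmf \<mu> \<subseteq> M i" for i \<mu>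
        using no dev_le[OF that] that
        by (intro steep_util_no_gain[OF pre[OF th] pre[OF th'], where S = "S i"]) (auto simp: S_def rk_def)
      then have "lam \<in> MNE M g ?u" by (simp add: MNE_def ind supp)
      from unique[OF th' u this] ind ne show False by simp
    qed
    show "S i \<subseteq> {f \<theta>'}" if th': "\<theta>' \<in> Theta"
      and "\<forall>j z z'. j \<noteq> i \<longrightarrow> z \<in> S i \<longrightarrow> pref \<theta>' j z z'"
      and "\<forall>z\<in>S i. \<forall>z'\<in>S i. pref \<theta>' i z z'" for \<theta>' i
    proof
      have top: "\<And>j z z'. j \<noteq> i \<Longrightarrow> z \<in> S i \<Longrightarrow> pref \<theta>' j z z'"
        and indiff: "\<And>z z'. z \<in> S i \<Longrightarrow> z' \<in> S i \<Longrightarrow> pref \<theta>' i z z'"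
        using that by blast+
      fix z assume "z \<in> S i"
      then obtain \<mu> where mu: "set_pmf \<mu> \<subseteq> M i" and z: "z \<in> set_pmf (induced_lottery g (lam(i := \<mu>)))"
        by (auto simp: S_def)
      let ?l = "lam(i := \<mu>)"
      have inS: "w \<in> S i" if "w \<in> set_pmf (induced_lottery g (lam(i := \<nu>)))" "set_pmf \<nu> \<subseteq> M i" for w \<nu>
        using that by (auto simp: S_def)
      \<comment> \<open>After the move to \<open>\<mu>\<close>, further deviations of
        \<open>i\<close> stay inside \<open>S i\<close>, where \<open>i\<close> is indifferent, and
        every other agent already receives a global optimum.\<close>
      have "exp_util (rk \<theta>' j) (induced_lottery g (?l(j := \<nu>))) \<le> exp_util (rk \<theta>' j) (induced_lottery g ?l)"
        if nu: "set_pmf \<nu> \<subseteq> M j" for j \<nu>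
      proof (cases "j = i")
        case True
        have const: "rk \<theta>' i w = rk \<theta>' i z" if "w \<in> S i" for w
          using indiff[of w z] indiff[of z w] that \<open>z \<in> S i\<close> by (simp add: rep[OF th'])
        have "exp_util (rk \<theta>' i) (induced_lottery g (lam(i := \<kappa>))) = rk \<theta>' i z" if "set_pmf \<kappa> \<subseteq> M i" for \<kappa>
          using const inS that by (intro exp_util_constant) blast
        with nu mu True show ?thesis by simp
      next
        case False
        have max: "rk \<theta>' j w \<le> rk \<theta>' j z" for w
          using top[OF False \<open>z \<in> S i\<close>] by (simp add: rep[OF th'])
        have "rk \<theta>' j w = rk \<theta>' j z" if "w \<in> S i" for w
          using top[OF False that, of z] max[of w] by (simp add: rep[OF th'])
        then have "exp_util (rk \<theta>' j) (induced_lottery g ?l) = rk \<theta>' j z"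
          using inS mu by (intro exp_util_constant) blast
        with max show ?thesis by (auto intro: exp_util_le)
      qed
      then have "?l \<in> MNE M g (rk \<theta>')" using supp mu by (auto simp: MNE_def)
      from unique[OF th' rk[OF th'] this] z show "z \<in> {f \<theta>'}" by simp
    qed
  qed
  then show ?thesis by blast
qed

section \<open>Menus\<close>

text \<open>The outcome \<open>z'\<close> receives weight \<open>1 / (n + 2)\<close> and may lie
  above \<open>b\<close>; through it the mixtures reach all of \<open>S\<close>.\<close>

definition menu :: "('z \<Rightarrow> 'z \<Rightarrow> bool) \<Rightarrow> 'z \<Rightarrow> 'z set \<Rightarrow> nat \<Rightarrow> 'z pmf set" where
  "menu R b S n = return_pmf ` {z \<in> S. R b z} \<union>
     (\<lambda>(z, z'). blend n (return_pmf z') (return_pmf z)) ` ({z \<in> S. \<not> R z b} \<times> S)"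

lemma finite_menu_lotteries: "finite (menu R b S n)" for b :: "'z::finite"
  by (simp add: menu_def)

lemma menu_support:
  assumes "(\<exists>z\<in>S. \<not> R z b) \<or> (\<forall>z\<in>S. R b z)"
  shows "(\<Union>y\<in>menu R b S n. set_pmf y) = S"
  using assms by (auto simp: menu_def)

lemma menu_gain:
  fixes b :: "'z::finite"
  assumes rev: "reversal R R' b S" and v: "represents v R'"
  obtains y where "y \<in> menu R b S n" "exp_util v y > v b"
  using rev unfolding reversal_def
proof (elim disjE conjE bexE)
  fix z assume "z \<in> S" "R b z" "\<not> R' b z"
  with v show thesis by (intro that[of "return_pmf z"]) (auto simp: menu_def represents_def)
next
  fix z z' assume "z \<in> S" "\<not> R z b" "R' z b" "z' \<in> S" "\<not> R' b z'"
  moreover from this v have "v z \<ge> v b" "v z' > v b" by (auto simp: represents_def)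
  moreover from this have "v b < v z + (v z' - v z) / (real n + 2)"
  proof -
    have "v z + (v z' - v z) / (real n + 2) = (v z * (real n + 1) + v z') / (real n + 2)"
      by (simp add: field_simps)
    moreover have "v b * (real n + 1) \<le> v z * (real n + 1)"
      using \<open>v z \<ge> v b\<close> by (intro mult_right_mono) auto
    ultimately show ?thesis using \<open>v z' > v b\<close> by (simp add: pos_less_divide_eq algebra_simps)
  qed
  ultimately show thesis
    by (intro that[of "blend n (return_pmf z') (return_pmf z)"]) (auto simp: menu_def exp_util_blend)
qed

text \<open>Here \<open>v\<close> need not represent \<open>R\<close>: in use it belongs to another
  state. Outcomes up to \<open>b\<close> are offered purely; one above \<open>b\<close> appears
  mixed with a lower outcome whose utility is already known to be \<open>v b\<close>.\<close>

lemma menu_indifference: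
  fixes b :: "'z::finite"
  assumes R: "complete_preorder R" and b: "b \<in> S" and S: "(\<exists>z\<in>S. \<not> R z b) \<or> (\<forall>z\<in>S. R b z)"
    and eq: "\<And>y y'. y \<in> menu R b S n \<Longrightarrow> y' \<in> menu R b S n \<Longrightarrow> exp_util v y = exp_util v y'"
    and z: "z \<in> S"
  shows "v z = v b"
proof -
  have total: "R x y \<or> R y x" for x y using R by (auto simp: complete_preorder_def)
  have low: "v w = v b" if "w \<in> S" "R b w" for w
    using eq[of "return_pmf w" "return_pmf b"] that b total[of b b] by (simp add: menu_def)
  show ?thesis
  proof (cases "R b z")
    case False
    with S z obtain w where w: "w \<in> S" "\<not> R w b" by blast
    then have "v w = v b" using total low by blast
    have "exp_util v (blend n (return_pmf z) (return_pmf w)) = exp_util v (return_pmf b)"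
      using w z b total[of b b] by (intro eq) (auto simp: menu_def)
    with \<open>v w = v b\<close> show ?thesis by (simp add: exp_util_blend)
  qed (use low z in blast)
qed

text \<open>Each of the finitely many mixtures tends to a value strictly below \<open>v b\<close>,
  so one threshold for \<open>n\<close>, depending on \<open>v\<close>, serves all.\<close>

lemma eventually_menu_no_gain:
  fixes b :: "'z::finite"
  assumes v: "represents v R"
  shows "\<forall>\<^sub>F n in sequentially. \<forall>y\<in>menu R b S n. exp_util v y \<le> v b"
proof -
  have "\<forall>\<^sub>F n in sequentially. \<not> R z b \<longrightarrow> exp_util v (blend n (return_pmf z') (return_pmf z)) \<le> v b" for z z'
  proof (cases "R z b")
    case False
    then have "exp_util v (return_pmf z) < v b" using v by (simp add: represents_def)
    from order_tendstoD(2)[OF blend_tendsto[of v "return_pmf z'"] this] show ?thesis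
      by (rule eventually_mono) auto
  qed simp
  then have "\<forall>\<^sub>F n in sequentially. \<forall>z z'. \<not> R z b \<longrightarrow> exp_util v (blend n (return_pmf z') (return_pmf z)) \<le> v b"
    by (intro eventually_all_finite)
  then show ?thesis
    by (rule eventually_mono) (use v in \<open>auto simp: menu_def represents_def\<close>)
qed

section \<open>From rational to real utilities\<close>

lemma implementable_Rats_imp_real:
  fixes Theta :: "'s set"
    and pref :: "'s \<Rightarrow> 'i::finite \<Rightarrow> 'z::finite \<Rightarrow> 'z \<Rightarrow> bool"
    and f :: "'s \<Rightarrow> 'z"
  assumes card: "CARD('i) \<ge> 3" and fin: "finite Theta"
    and pre: "\<And>\<theta> i. \<theta> \<in> Theta \<Longrightarrow> complete_preorder (pref \<theta> i)"
    and two: "card (f ` Theta) \<ge> 2"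
    and impl: "mixed_Nash_implementable Theta pref f \<rat>"
  shows "mixed_Nash_implementable Theta pref f UNIV"
proof -
  obtain S :: "'s \<Rightarrow> 'i \<Rightarrow> 'z set" where S: "\<And>\<theta>. \<theta> \<in> Theta \<Longrightarrow> deviation_support Theta pref f \<theta> (S \<theta>)"
    using ex_deviation_support[OF impl pre] by metis
  have quo: "f \<theta> \<in> S \<theta> i"
    and low: "(\<exists>z\<in>S \<theta> i. \<not> pref \<theta> i z (f \<theta>)) \<or> (\<forall>z\<in>S \<theta> i. pref \<theta> i (f \<theta>) z)"
    if "\<theta> \<in> Theta" for \<theta> i
    using S[OF that] unfolding deviation_support_def by blast+
  have rev: "\<exists>i. reversal (pref \<theta> i) (pref \<theta>' i) (f \<theta>) (S \<theta> i)"
    if "\<theta> \<in> Theta" "\<theta>' \<in> Theta" "f \<theta>' \<noteq> f \<theta>" for \<theta> \<theta>'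
    using S[OF that(1)] that(2,3) unfolding deviation_support_def by blast
  have flat: "S \<theta> i \<subseteq> {f \<theta>'}"
    if "\<theta> \<in> Theta" "\<theta>' \<in> Theta" "\<And>j z z'. j \<noteq> i \<Longrightarrow> z \<in> S \<theta> i \<Longrightarrow> pref \<theta>' j z z'"
      "\<And>z z'. z \<in> S \<theta> i \<Longrightarrow> z' \<in> S \<theta> i \<Longrightarrow> pref \<theta>' i z z'" for \<theta> \<theta>' i
  proof -
    have "(\<forall>j z z'. j \<noteq> i \<longrightarrow> z \<in> S \<theta> i \<longrightarrow> pref \<theta>' j z z') \<longrightarrow>
        (\<forall>z\<in>S \<theta> i. \<forall>z'\<in>S \<theta> i. pref \<theta>' i z z') \<longrightarrow> S \<theta> i \<subseteq> {f \<theta>'}"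
      using S[OF that(1)] that(2) unfolding deviation_support_def by simp
    with that(3,4) show ?thesis by simp
  qed
  have nonempty: "Theta \<noteq> {}" using two by auto
  \<comment> \<open>a report codes a state and the integer bounding the mixing weights\<close>
  define state where "state c = from_nat_into Theta (fst (prod_decode c))" for c
  have state: "state c \<in> Theta" for c by (simp add: state_def from_nat_into nonempty)
  define a where "a c = f (state c)" for c
  define D where "D c i = menu (pref (state c) i) (a c) (S (state c) i) (snd (prod_decode c))" for c i
  have support_D: "(\<Union>y\<in>D c i. set_pmf y) = S (state c) i" for c i
    unfolding D_def a_def by (rule menu_support[OF low[OF state]])
  interpret canonical_mechanism a D
  proof
    fix c i
    have "pref (state c) i (a c) (a c)"
      using pre[OF state[of c], of i] by (auto simp: complete_preorder_def)
    then show "return_pmf (a c) \<in> D c i"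
      by (simp add: D_def menu_def a_def quo[OF state])
  qed (simp_all add: card D_def finite_menu_lotteries)
  have "(\<Union>lam\<in>MNE (\<lambda>_. UNIV) outcome u. set_pmf (induced_lottery outcome lam)) = {f \<theta>}"
    if th: "\<theta> \<in> Theta" and u: "u \<in> cardinal_states (pref \<theta>) UNIV" for \<theta> u
  proof -
    have rep: "represents (u i) (pref \<theta> i)" for i using u by (simp add: cardinal_states_iff)
    have rep': "pref \<theta> i z z' \<longleftrightarrow> u i z \<ge> u i z'" for i z z' using rep[of i] by (simp add: represents_def)
    \<comment> \<open>A reversal pays for every integer carried by \<open>c\<close>, so no choice of
      it protects a consensus on a wrong outcome.\<close>
    have gain: "\<exists>i. \<exists>y\<in>D c i. exp_util (u i) y > u i (a c)" if ne: "f \<theta> \<noteq> a c" for c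
    proof -
      obtain i where "reversal (pref (state c) i) (pref \<theta> i) (a c) (S (state c) i)"
        using rev[OF state th] ne by (auto simp: a_def)
      from menu_gain[OF this rep] show ?thesis by (metis D_def)
    qed
    have unique: "z = f \<theta>" if "lam \<in> MNE (\<lambda>_. UNIV) outcome u" "z \<in> set_pmf (induced_lottery outcome lam)" for lam z
      using that
    proof (cases rule: equilibrium_cases)
      case (consensus c)
      have "f \<theta> = a c"
      proof (rule ccontr)
        assume "f \<theta> \<noteq> a c"
        then obtain i y where "y \<in> D c i" "exp_util (u i) y > u i (a c)" using gain by blast
        with consensus(2) show False using leD by blast
      qed
      with consensus(1) show ?thesis by simp
    next
      case (challenge c i)
      have "S (state c) i \<subseteq> {f \<theta>}"
      proof (rule flat[OF state th])
        show "pref \<theta> j w w'" if "j \<noteq> i" "w \<in> S (state c) i" for j w w'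
          using challenge(2)[of j w w'] that by (simp add: support_D rep')
        have "u i w = u i (a c)" if "w \<in> S (state c) i" for w
          using challenge(3) unfolding D_def a_def
          by (intro menu_indifference[OF pre[OF state] quo[OF state] low[OF state] _ that]) auto
        then show "pref \<theta> i w w'" if "w \<in> S (state c) i" "w' \<in> S (state c) i" for w w'
          using that by (simp add: rep')
      qed
      then show ?thesis using challenge(1) by (auto simp: support_D)
    next
      case indifference
      \<comment> \<open>Universal indifference at \<open>\<theta>\<close> leaves no room for a
        reversal towards \<open>\<theta>\<close>, so \<open>f\<close> would be constant.\<close>
      have "f ` Theta \<subseteq> {f \<theta>}"
      proof (rule image_subsetI)
        fix \<theta>' assume th': "\<theta>' \<in> Theta"
        show "f \<theta>' \<in> {f \<theta>}"
        proof (rule ccontr)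
          assume "f \<theta>' \<notin> {f \<theta>}"
          then obtain i where "reversal (pref \<theta>' i) (pref \<theta> i) (f \<theta>') (S \<theta>' i)"
            using rev[OF th' th] by auto
          then obtain z where "\<not> pref \<theta> i (f \<theta>') z" by (auto simp: reversal_def)
          with indifference[of i "f \<theta>'" z] show False by (simp add: rep')
        qed
      qed
      then have "card (f ` Theta) \<le> card {f \<theta>}" by (intro card_mono) auto
      with two show ?thesis by simp
    qed
    have "\<exists>lam\<in>MNE (\<lambda>_. UNIV) outcome u. induced_lottery outcome lam = return_pmf (f \<theta>)"
    proof -
      \<comment> \<open>There are finitely many agents, so a single \<open>n\<close> makes all menus
        unprofitable at this \<open>u\<close>; the report coding \<open>\<theta>\<close> and
        \<open>n\<close> is then an equilibrium consensus.\<close>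
      have "\<forall>\<^sub>F n in sequentially. \<forall>i. \<forall>y\<in>menu (pref \<theta> i) (f \<theta>) (S \<theta> i) n. exp_util (u i) y \<le> u i (f \<theta>)"
        by (intro eventually_all_finite eventually_menu_no_gain rep)
      then obtain n where n: "\<forall>i. \<forall>y\<in>menu (pref \<theta> i) (f \<theta>) (S \<theta> i) n. exp_util (u i) y \<le> u i (f \<theta>)"
        by (auto dest: eventually_happens)
      obtain t where t: "from_nat_into Theta t = \<theta>"
        using subset_range_from_nat_into[OF countable_finite[OF fin]] th by blast
      define c where "c = prod_encode (t, n)"
      have "state c = \<theta>" by (simp add: c_def state_def t)
      then have c: "a c = f \<theta>" "\<And>i. D c i = menu (pref \<theta> i) (f \<theta>) (S \<theta> i) n"
        by (auto simp: a_def D_def c_def)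
      from consensus_equilibrium[of c u] n show ?thesis by (simp add: c)
    qed
    then obtain lam where "lam \<in> MNE (\<lambda>_. UNIV) outcome u"
      "f \<theta> \<in> set_pmf (induced_lottery outcome lam)"
      by (metis set_return_pmf singletonI)
    with unique show ?thesis by blast
  qed
  then show ?thesis
    unfolding mixed_Nash_implementable_def by (intro exI[of _ "\<lambda>_. UNIV"] exI[of _ outcome]) auto
qed

theorem theorem4:
  fixes Theta :: "'s set"
    and pref :: "'s \<Rightarrow> 'i::finite \<Rightarrow> 'z::finite \<Rightarrow> 'z \<Rightarrow> bool"
    and f :: "'s \<Rightarrow> 'z"
  assumes "CARD('i) \<ge> 3"
    and "finite Theta"
    and "\<forall>\<theta>\<in>Theta. \<forall>i. complete_preorder (pref \<theta> i)"
    and "card (f ` Theta) \<ge> 2"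
  shows "mixed_Nash_implementable Theta pref f UNIV \<longleftrightarrow> mixed_Nash_implementable Theta pref f \<rat>"
proof
  have "cardinal_states P \<rat> \<subseteq> cardinal_states P UNIV" for P :: "'i \<Rightarrow> 'z \<Rightarrow> 'z \<Rightarrow> bool"
    by (auto simp: cardinal_states_def)
  then show "mixed_Nash_implementable Theta pref f \<rat>" if "mixed_Nash_implementable Theta pref f UNIV"
    using that unfolding mixed_Nash_implementable_def by (meson subsetD)
  show "mixed_Nash_implementable Theta pref f UNIV" if "mixed_Nash_implementable Theta pref f \<rat>"
    using assms that by (intro implementable_Rats_imp_real) auto
qed

end
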